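(* Let $\beta>0$, $L>0$ and $x_0\neq0$. Assume $\Delta=\Delta(n)$ satisfies $\Delta=O(1)$ and $\Delta^{-1}=O(n)$. There exists $C>0$ such that for $n$ large enough and for any estimator $\hat g_n(x_0)$ (measurable function of the observations $Z_1^\Delta,\dots,Z_n^\Delta$), $$\sup_{g\in\mathcal H(\beta,L)}\mathbb E_g\big[(\hat g_n(x_0)-g(x_0))^2\big]\ge C(n\Delta)^{-\frac{2\beta}{2\beta+1}},$$ where the supremum is over functions $g\in\mathcal H(\beta,L)$ of the form $g(x)=xN(x)$ with $N$ a Lévy density such that $g$ is integrable, and $\mathbb E_g$ denotes expectation when $Z_k^\Delta$ are the increments of the corresponding Lévy process.
   Context: For a Lévy density $N$ with $g(x)=xN(x)$ integrable, $(L_t)$ denotes the real-valued pure-jump Lévy process with characteristic function $\mathbb{E}[e^{iuL_t}]=\exp\big(t\int_{\mathbb R}(e^{iux}-1)N(x)dx\big)$, observed at times $k\Delta$, $k=1,\dots,n$, with increments $Z_k^\Delta=L_{k\Delta}-L_{(k-1)\Delta}$. For $\beta>0$, $\lfloor\beta\rfloor$ is the largest integer strictly smaller than $\beta$. Hölder class $\mathcal H(\beta,L)$ ($l=\lfloor\beta\rfloor$): functions $f:\mathbb R\to\mathbb R$ whose derivative $f^{(l)}$ exists and satisfies $|f^{(l)}(x)-f^{(l)}(y)|\le L|x-y|^{\beta-l}$ for all $x,y\in\mathbb R$. *)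

theory Defs
  imports "HOL-Probability.Probability" "HOL-Library.Landau_Symbols"
begin

definition holder_order :: "real \<Rightarrow> nat" where
  "holder_order \<beta> = nat (\<lceil>\<beta>\<rceil> - 1)"

definition holder_class :: "real \<Rightarrow> real \<Rightarrow> (real \<Rightarrow> real) set" where
  "holder_class \<beta> L = {f.
     (\<forall>k < holder_order \<beta>. \<forall>x. (deriv ^^ k) f differentiable (at x)) \<and>
     (\<forall>x y. \<bar>(deriv ^^ holder_order \<beta>) f x - (deriv ^^ holder_order \<beta>) f y\<bar>
              \<le> L * \<bar>x - y\<bar> powr (\<beta> - real (holder_order \<beta>)))}"

definition levy_density :: "(real \<Rightarrow> real) \<Rightarrow> bool" where
  "levy_density N \<longleftrightarrow> N \<in> borel_measurable borel \<and> (\<forall>x. 0 \<le> N x) \<and>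
     integrable lborel (\<lambda>x. min 1 (x\<^sup>2) * N x)"

text \<open>Law of an increment over a time step Delta of the pure-jump Levy process with
  characteristic function exp(t * int (e^{iux}-1) N(x) dx).\<close>
definition levy_incr_law :: "real \<Rightarrow> (real \<Rightarrow> real) \<Rightarrow> real measure" where
  "levy_incr_law \<Delta> N = (THE \<mu>. prob_space \<mu> \<and> sets \<mu> = sets borel \<and>
     (\<forall>u. char \<mu> u = exp (complex_of_real \<Delta> *
        (CLINT x|lborel. (iexp (u * x) - 1) * complex_of_real (N x)))))"

definition levy_holder_class :: "real \<Rightarrow> real \<Rightarrow> (real \<Rightarrow> real) set" where
  "levy_holder_class \<beta> L = {N. levy_density N \<and> integrable lborel (\<lambda>x. x * N x) \<and>
     (\<lambda>x. x * N x) \<in> holder_class \<beta> L}"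

end

theory Submission
  imports Defs
begin

text \<open>
  Le Cam's two-point method with finite Levy densities. Let \<open>\<phi>\<close> be the standard normal density. The hypotheses are
  \<open>N\<^sub>0 = A \<phi>\<close> and \<open>N\<^sub>1 = N\<^sub>0 + a h\<^sup>\<beta> \<psi>((x - x\<^sub>0) / h)\<close>, where \<open>\<psi> = - \<phi>''\<close> has mean zero and \<open>h\<close> is a small
  multiple of \<open>(n \<Delta>) powr (- 1 / (2 \<beta> + 1))\<close>. Both densities have total mass \<open>A\<close>, so both increments are compound
  Poisson with the same jump rate. Adding up the jumps, mixing over their number and taking \<open>n\<close> independent
  copies turn the chi-square distance of the jump laws, of order \<open>h powr (2 \<beta> + 1)\<close>, into an
  exponential factor that is bounded uniformly in \<open>n\<close>. The targets differ by a multiple of \<open>h\<^sup>\<beta>\<close>, hence the rate.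
\<close>

section \<open>Compound Poisson laws\<close>

primrec conv_power :: "real measure \<Rightarrow> nat \<Rightarrow> real measure" where
  "conv_power M 0 = return borel 0"
| "conv_power M (Suc k) = (M \<star> conv_power M k)"

lemma prob_space_convolution:
  fixes M N :: "real measure"
  assumes "prob_space M" "prob_space N" "sets M = sets borel" "sets N = sets borel"
  shows "prob_space (M \<star> N)"
proof -
  interpret M: prob_space M by fact
  interpret N: prob_space N by fact
  interpret pair_prob_space M N ..
  note assms(3,4)[measurable_cong]
  show ?thesis
    unfolding convolution_def by (rule prob_space_distr) measurable
qed

lemma char_convolution:
  fixes M N :: "real measure"
  assumes "prob_space M" "prob_space N" and [measurable_cong]: "sets M = sets borel" "sets N = sets borel"
  shows "char (M \<star> N) t = char M t * char N t"
proof -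
  interpret M: prob_space M by fact
  interpret N: prob_space N by fact
  interpret pair_prob_space M N ..
  have int: "integrable (M \<Otimes>\<^sub>M N) (\<lambda>(x, y). iexp (t * x) * iexp (t * y))"
    by (rule P.integrable_const_bound[where B = 1]) (auto simp: norm_mult)
  have "char (M \<star> N) t = (CLINT p|M \<Otimes>\<^sub>M N. iexp (t * (fst p + snd p)))"
    unfolding char_def convolution_def
    by (subst integral_distr) (auto simp: case_prod_beta')
  also have "\<dots> = (CLINT p|M \<Otimes>\<^sub>M N. (case p of (x, y) \<Rightarrow> iexp (t * x) * iexp (t * y)))"
    by (intro Bochner_Integration.integral_cong refl)
       (auto simp: exp_add[symmetric] ring_distribs)
  also have "\<dots> = (CLINT x|M. CLINT y|N. iexp (t * x) * iexp (t * y))"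
    using integral_fst'[OF int] by simp
  also have "\<dots> = char M t * char N t"
    by (simp add: char_def)
  finally show ?thesis .
qed

lemma sets_conv_power [simp, measurable_cong]: "sets (conv_power M k) = sets borel"
  by (cases k) auto

lemma prob_space_conv_power:
  assumes "prob_space M" "sets M = sets borel"
  shows "prob_space (conv_power M k)"
  using assms by (induction k) (auto intro: prob_space_return prob_space_convolution)

lemma char_conv_power:
  assumes "prob_space M" "sets M = sets borel"
  shows "char (conv_power M k) t = char M t ^ k"
proof (induction k)
  case 0
  show ?case by (simp add: char_def integral_return)
next
  case (Suc k)
  then show ?case
    using assms by (simp add: char_convolution prob_space_conv_power)
qed

text \<open>The mixture formula \<open>integral_compound_poisson\<close> is stated for real
  integrands, so characteristic functions are compared through their cosine and sine parts.\<close>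

lemma char_Re_Im:
  assumes "prob_space P" and [measurable_cong]: "sets P = sets borel"
  shows "Re (char P t) = (\<integral>x. cos (t * x) \<partial>P)" "Im (char P t) = (\<integral>x. sin (t * x) \<partial>P)"
proof -
  interpret prob_space P by fact
  have "integrable P (\<lambda>x. iexp (t * x))"
    by (rule integrable_const_bound[where B = 1]) auto
  then show "Re (char P t) = (\<integral>x. cos (t * x) \<partial>P)" "Im (char P t) = (\<integral>x. sin (t * x) \<partial>P)"
    unfolding char_def by (simp_all flip: integral_Re integral_Im add: Re_exp Im_exp)
qed

section \<open>Poisson mixtures of convolution powers\<close>

lemma integral_poisson_power:
  fixes z :: complex
  assumes "r > 0" "norm z \<le> 1"
  shows "(CLINT k|measure_pmf (poisson_pmf r). z ^ k) = exp (of_real r * (z - 1))"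
proof -
  have "integrable (measure_pmf (poisson_pmf r)) (\<lambda>k. z ^ k)"
    by (rule measure_pmf.integrable_const_bound[where B = 1])
       (auto simp: norm_power assms power_le_one)
  then have "integrable (density (count_space UNIV) (pmf (poisson_pmf r))) (\<lambda>k. z ^ k)"
    by (simp add: measure_pmf_eq_density)
  then have int: "integrable (count_space UNIV) (\<lambda>k. pmf (poisson_pmf r) k *\<^sub>R z ^ k)"
    by (subst (asm) integrable_density) auto
  have "(CLINT k|measure_pmf (poisson_pmf r). z ^ k) =
      (CLINT k|count_space UNIV. pmf (poisson_pmf r) k *\<^sub>R z ^ k)"
    unfolding measure_pmf_eq_density by (subst integral_density) auto
  also have "\<dots> = (\<Sum>k. pmf (poisson_pmf r) k *\<^sub>R z ^ k)"
    by (rule integral_count_space_nat[OF int])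
  also have "\<dots> = (\<Sum>k. exp (- of_real r) * ((of_real r * z) ^ k /\<^sub>R fact k))"
    using \<open>r > 0\<close>
    by (intro suminf_cong)
       (simp add: scaleR_conv_of_real power_mult_distrib divide_inverse exp_of_real[symmetric] mult_ac
         flip: of_real_minus)
  also have "\<dots> = exp (- of_real r) * exp (of_real r * z)"
    by (subst (2) exp_def, rule suminf_mult[OF summable_exp_generic])
  also have "\<dots> = exp (of_real r * (z - 1))"
    by (simp add: exp_add[symmetric] ring_distribs)
  finally show ?thesis .
qed

text \<open>The law of a sum of a Poisson number of independent jumps with law \<open>M\<close>. The
  bind keeps the number of jumps visible: integrals become a Poisson average over \<open>k\<close>
  of integrals against \<open>conv_power M k\<close>.\<close>

definition compound_poisson :: "real \<Rightarrow> real measure \<Rightarrow> real measure" where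
  "compound_poisson r M = measure_pmf (poisson_pmf r) \<bind> conv_power M"

context
  fixes M :: "real measure"
  assumes prob_M: "prob_space M" and sets_M: "sets M = sets borel"
begin

lemma measurable_conv_power:
  "conv_power M \<in> measurable (measure_pmf p) (subprob_algebra borel)"
  by (auto simp: space_subprob_algebra prob_space_conv_power[OF prob_M sets_M]
      prob_space_imp_subprob_space)

lemma sets_compound_poisson: "sets (compound_poisson r M) = sets borel"
  unfolding compound_poisson_def by (rule sets_bind) auto

lemma prob_space_compound_poisson: "prob_space (compound_poisson r M)"
  unfolding compound_poisson_def
  by (rule prob_space.prob_space_bind[OF _ _ measurable_conv_power])
     (auto simp: prob_space_measure_pmf prob_space_conv_power[OF prob_M sets_M])

lemma nn_integral_compound_poisson:
  assumes "f \<in> borel_measurable borel"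
  shows "(\<integral>\<^sup>+x. f x \<partial>compound_poisson r M) =
    (\<integral>\<^sup>+k. \<integral>\<^sup>+x. f x \<partial>conv_power M k \<partial>measure_pmf (poisson_pmf r))"
  unfolding compound_poisson_def by (rule nn_integral_bind[OF assms measurable_conv_power])

lemma integral_compound_poisson:
  fixes f :: "real \<Rightarrow> real"
  assumes "f \<in> borel_measurable borel" "\<And>x. \<bar>f x\<bar> \<le> B"
  shows "(\<integral>x. f x \<partial>compound_poisson r M) =
    (\<integral>k. \<integral>x. f x \<partial>conv_power M k \<partial>measure_pmf (poisson_pmf r))"
  unfolding compound_poisson_def
proof (rule integral_bind[OF assms(1) _ measurable_conv_power, where B = B and B' = 1])
  show "AE k in measure_pmf (poisson_pmf r).
      emeasure (conv_power M k) (space (conv_power M k)) \<le> ennreal 1"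
    by (simp add: prob_space.emeasure_space_1[OF prob_space_conv_power[OF prob_M sets_M]])
qed (use assms in \<open>auto intro: measure_pmf.finite_measure_axioms\<close>)

text \<open>Given \<open>k\<close> jumps the characteristic function is \<open>char M t ^ k\<close>;
  averaging over \<open>k\<close> evaluates the generating function of the Poisson law at
  \<open>char M t\<close>, a point of the closed unit disc.\<close>

lemma char_compound_poisson:
  assumes "r > 0"
  shows "char (compound_poisson r M) t = exp (of_real r * (char M t - 1))"
proof -
  interpret M: real_distribution M
    by (rule real_distribution.intro[OF prob_M]) (unfold_locales, rule sets_M)
  have le1: "norm (char M t) \<le> 1" by (rule M.cmod_char_le_1)
  note power = char_conv_power[OF prob_M sets_M]
  have int: "integrable (measure_pmf (poisson_pmf r)) (\<lambda>k. char M t ^ k)"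
    by (rule measure_pmf.integrable_const_bound[where B = 1])
       (auto simp: norm_power le1 power_le_one)
  have "char (compound_poisson r M) t = (CLINT k|measure_pmf (poisson_pmf r). char M t ^ k)"
  proof (rule complex_eqI)
    note CP = char_Re_Im[OF prob_space_compound_poisson sets_compound_poisson]
    note pow = char_Re_Im[OF prob_space_conv_power[OF prob_M sets_M] sets_conv_power, unfolded power]
    show "Re (char (compound_poisson r M) t) = Re (CLINT k|measure_pmf (poisson_pmf r). char M t ^ k)"
      unfolding CP integral_Re[OF int, symmetric] pow
      by (rule integral_compound_poisson[where B = 1]) auto
    show "Im (char (compound_poisson r M) t) = Im (CLINT k|measure_pmf (poisson_pmf r). char M t ^ k)"
      unfolding CP integral_Im[OF int, symmetric] pow
      by (rule integral_compound_poisson[where B = 1]) auto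
  qed
  then show ?thesis
    by (simp add: integral_poisson_power[OF assms le1])
qed

end

section \<open>Increments of a process with finite Levy density\<close>

lemma levy_incr_law_eqI:
  assumes "prob_space P" "sets P = sets borel"
    and char: "\<And>u. char P u = exp (complex_of_real \<Delta> *
        (CLINT x|lborel. (iexp (u * x) - 1) * complex_of_real (N x)))"
  shows "levy_incr_law \<Delta> N = P"
  unfolding levy_incr_law_def
proof (rule the_equality)
  fix Q assume Q: "prob_space Q \<and> sets Q = sets borel \<and>
     (\<forall>u. char Q u = exp (complex_of_real \<Delta> *
        (CLINT x|lborel. (iexp (u * x) - 1) * complex_of_real (N x))))"
  have "real_distribution Q" "real_distribution P"
    using Q assms by (auto simp: real_distribution_def real_distribution_axioms_def)
  then show "Q = P"
    by (rule Levy_uniqueness) (use Q char in auto)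
qed (use assms in auto)

text \<open>Finite mass \<open>c\<close> allows the integral of
  \<open>(iexp (u * x) - 1) * N x\<close> to be split, which gives \<open>c * (char M u - 1)\<close>
  with the normalised jump law \<open>M\<close>. After multiplication by the time step this is the
  exponent of a compound Poisson law, and a characteristic function determines its law.\<close>

lemma levy_incr_law_finite:
  assumes [measurable]: "N \<in> borel_measurable borel" and nonneg: "\<And>x. 0 \<le> N x"
    and int: "integrable lborel N" and mass: "(\<integral>x. N x \<partial>lborel) = c" and "c > 0" "\<Delta> > 0"
  defines "M \<equiv> density lborel (\<lambda>x. ennreal (N x / c))"
  shows "prob_space M" "levy_incr_law \<Delta> N = compound_poisson (\<Delta> * c) M"
proof -
  have [simp]: "sets M = sets borel" by (simp add: M_def)
  have "(\<integral>\<^sup>+x. ennreal (N x / c) \<partial>lborel) = ennreal (\<integral>x. N x / c \<partial>lborel)"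
    using int nonneg \<open>c > 0\<close> by (intro nn_integral_eq_integral) auto
  also have "\<dots> = 1"
    using mass \<open>c > 0\<close> by simp
  finally show prob: "prob_space M"
    unfolding M_def by (intro prob_spaceI) (simp add: emeasure_density)
  show "levy_incr_law \<Delta> N = compound_poisson (\<Delta> * c) M"
  proof (rule levy_incr_law_eqI[OF prob_space_compound_poisson sets_compound_poisson])
    fix u
    have int_c: "complex_integrable lborel (\<lambda>x. complex_of_real (N x))"
      using int by simp
    have int_e: "complex_integrable lborel (\<lambda>x. iexp (u * x) * complex_of_real (N x))"
      by (rule Bochner_Integration.integrable_bound[OF int]) (auto simp: norm_mult)
    have "char M u = (CLINT x|lborel. (N x / c) *\<^sub>R iexp (u * x))"
      unfolding char_def M_def using nonneg \<open>c > 0\<close> by (subst integral_density) auto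
    also have "\<dots> = (CLINT x|lborel. (1 / complex_of_real c) * (iexp (u * x) * complex_of_real (N x)))"
      by (intro Bochner_Integration.integral_cong) (auto simp: scaleR_conv_of_real)
    also have "\<dots> = (1 / complex_of_real c) * (CLINT x|lborel. iexp (u * x) * complex_of_real (N x))"
      by simp
    finally have *: "complex_of_real c * char M u = (CLINT x|lborel. iexp (u * x) * complex_of_real (N x))"
      using \<open>c > 0\<close> by simp
    have "(CLINT x|lborel. (iexp (u * x) - 1) * complex_of_real (N x))
        = (CLINT x|lborel. iexp (u * x) * complex_of_real (N x)) - complex_of_real c"
      using int_c int_e mass by (simp add: left_diff_distrib)
    also have "\<dots> = complex_of_real c * (char M u - 1)"
      by (simp add: * right_diff_distrib)
    finally show "char (compound_poisson (\<Delta> * c) M) u =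
        exp (complex_of_real \<Delta> * (CLINT x|lborel. (iexp (u * x) - 1) * complex_of_real (N x)))"
      using prob \<open>c > 0\<close> \<open>\<Delta> > 0\<close> by (simp add: char_compound_poisson mult.assoc)
  qed (use prob in auto)
qed

section \<open>Chi-square bounds in dual form\<close>

text \<open>The least such \<open>c\<close> is one plus the chi-square divergence. This dual form passes through
  convolutions, mixtures and products without identifying densities of the resulting laws.\<close>
definition chi2_bounded :: "ennreal \<Rightarrow> 'a measure \<Rightarrow> 'a measure \<Rightarrow> bool" where
  "chi2_bounded c P Q \<longleftrightarrow> sets P = sets Q \<and>
    (\<forall>f \<in> borel_measurable Q. (\<integral>\<^sup>+x. f x \<partial>P)\<^sup>2 \<le> c * (\<integral>\<^sup>+x. (f x)\<^sup>2 \<partial>Q))"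

lemma chi2_boundedD:
  "chi2_bounded c P Q \<Longrightarrow> f \<in> borel_measurable Q \<Longrightarrow>
    (\<integral>\<^sup>+x. f x \<partial>P)\<^sup>2 \<le> c * (\<integral>\<^sup>+x. (f x)\<^sup>2 \<partial>Q)"
  by (simp add: chi2_bounded_def)

lemma chi2_bounded_mono:
  assumes "chi2_bounded c P Q" "c \<le> d"
  shows "chi2_bounded d P Q"
  using assms unfolding chi2_bounded_def
  by (meson mult_right_mono order_trans zero_le)

text \<open>Cauchy-Schwarz for the factorisation of \<open>p * f\<close> into
  \<open>p / sqrt q\<close> and \<open>sqrt q * f\<close>. For probability densities the constant is
  one plus the chi-square divergence.\<close>

lemma chi2_bounded_density:
  fixes p q :: "'a \<Rightarrow> real"
  assumes [measurable]: "p \<in> borel_measurable M" "q \<in> borel_measurable M"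
    and p: "\<And>x. 0 \<le> p x" and q: "\<And>x. 0 < q x"
  shows "chi2_bounded (\<integral>\<^sup>+x. ennreal ((p x)\<^sup>2 / q x) \<partial>M) (density M p) (density M q)"
  unfolding chi2_bounded_def
proof safe
  fix f :: "'a \<Rightarrow> ennreal"
  assume "f \<in> borel_measurable (density M q)"
  then have [measurable]: "f \<in> borel_measurable M" by simp
  have "(\<integral>\<^sup>+x. f x \<partial>density M p) = (\<integral>\<^sup>+x. ennreal (p x / sqrt (q x)) * (ennreal (sqrt (q x)) * f x) \<partial>M)"
    using p q by (subst nn_integral_density)
      (auto intro!: nn_integral_cong simp: less_imp_le less_imp_neq[THEN not_sym] mult.assoc[symmetric] simp flip: ennreal_mult')
  also have "\<dots>\<^sup>2 \<le> (\<integral>\<^sup>+x. (ennreal (p x / sqrt (q x)))\<^sup>2 \<partial>M) * (\<integral>\<^sup>+x. (ennreal (sqrt (q x)) * f x)\<^sup>2 \<partial>M)"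
    by (rule Cauchy_Schwarz_nn_integral) measurable
  also have "(\<integral>\<^sup>+x. (ennreal (p x / sqrt (q x)))\<^sup>2 \<partial>M) = (\<integral>\<^sup>+x. ennreal ((p x)\<^sup>2 / q x) \<partial>M)"
    using p q by (intro nn_integral_cong) (auto simp: ennreal_power less_imp_le power_divide)
  also have "(\<integral>\<^sup>+x. (ennreal (sqrt (q x)) * f x)\<^sup>2 \<partial>M) = (\<integral>\<^sup>+x. (f x)\<^sup>2 \<partial>density M q)"
    using p q by (subst nn_integral_density)
      (auto intro!: nn_integral_cong simp: power_mult_distrib ennreal_power less_imp_le)
  finally show "(\<integral>\<^sup>+x. f x \<partial>density M p)\<^sup>2 \<le>
      (\<integral>\<^sup>+x. ennreal ((p x)\<^sup>2 / q x) \<partial>M) * (\<integral>\<^sup>+x. (f x)\<^sup>2 \<partial>density M q)" .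
qed simp_all

text \<open>Two changes of measure in succession: the bound for \<open>P1\<close> is applied to the
  inner integral over \<open>P2\<close>, seen as a function of \<open>x\<close>, and the bound for
  \<open>P2\<close> then to each translate of \<open>f\<close>.\<close>

lemma chi2_bounded_convolution:
  fixes P1 P2 Q1 Q2 :: "real measure"
  assumes fin: "finite_measure P1" "finite_measure P2" "finite_measure Q1" "finite_measure Q2"
    and [measurable_cong, simp]: "sets Q1 = sets borel" "sets Q2 = sets borel"
    and 1: "chi2_bounded c P1 Q1" and 2: "chi2_bounded d P2 Q2"
  shows "chi2_bounded (c * d) (P1 \<star> P2) (Q1 \<star> Q2)"
  unfolding chi2_bounded_def
proof safe
  fix f :: "real \<Rightarrow> ennreal"
  assume "f \<in> borel_measurable (Q1 \<star> Q2)"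
  then have [measurable]: "f \<in> borel_measurable borel" by simp
  have [measurable_cong, simp]: "sets P1 = sets borel" "sets P2 = sets borel"
    using 1 2 by (simp_all add: chi2_bounded_def)
  interpret P2: finite_measure P2 by fact
  interpret Q2: finite_measure Q2 by fact
  have "(\<integral>\<^sup>+z. f z \<partial>(P1 \<star> P2))\<^sup>2 = (\<integral>\<^sup>+x. \<integral>\<^sup>+y. f (x + y) \<partial>P2 \<partial>P1)\<^sup>2"
    by (simp add: nn_integral_convolution fin)
  also have "\<dots> \<le> c * (\<integral>\<^sup>+x. (\<integral>\<^sup>+y. f (x + y) \<partial>P2)\<^sup>2 \<partial>Q1)"
    by (rule chi2_boundedD[OF 1]) measurable
  also have "\<dots> \<le> c * (\<integral>\<^sup>+x. d * (\<integral>\<^sup>+y. (f (x + y))\<^sup>2 \<partial>Q2) \<partial>Q1)"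
    by (intro mult_left_mono nn_integral_mono chi2_boundedD[OF 2]) auto
  also have "\<dots> = c * d * (\<integral>\<^sup>+z. (f z)\<^sup>2 \<partial>(Q1 \<star> Q2))"
    by (simp add: nn_integral_convolution fin nn_integral_cmult mult.assoc)
  finally show "(\<integral>\<^sup>+z. f z \<partial>(P1 \<star> P2))\<^sup>2 \<le> c * d * (\<integral>\<^sup>+z. (f z)\<^sup>2 \<partial>(Q1 \<star> Q2))" .
qed simp_all

lemma chi2_bounded_conv_power:
  assumes "prob_space P" "prob_space Q" "sets Q = sets borel" "chi2_bounded c P Q"
  shows "chi2_bounded (c ^ k) (conv_power P k) (conv_power Q k)"
proof (induction k)
  case 0
  show ?case by (simp add: chi2_bounded_def nn_integral_return)
next
  case (Suc k)
  have "sets P = sets borel"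
    using assms(3,4) by (simp add: chi2_bounded_def)
  then have "prob_space (conv_power P k)" "prob_space (conv_power Q k)"
    using assms by (simp_all add: prob_space_conv_power)
  then show ?case
    unfolding conv_power.simps power_Suc
    by (intro chi2_bounded_convolution assms Suc.IH sets_conv_power prob_space.finite_measure)
qed

text \<open>The Poisson generating function again, now at a base that may exceed 1, as chi-square
  constants do. All terms are nonnegative, so summing the exponential series is enough.\<close>

lemma nn_integral_poisson_power:
  assumes "r > 0" "b \<ge> 0"
  shows "(\<integral>\<^sup>+k. ennreal b ^ k \<partial>measure_pmf (poisson_pmf r)) = ennreal (exp (r * (b - 1)))"
proof -
  have "(\<integral>\<^sup>+k. ennreal b ^ k \<partial>measure_pmf (poisson_pmf r)) =
      (\<Sum>k. ennreal (exp (- r) * ((r * b) ^ k /\<^sub>R fact k)))"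
    using assms
    by (simp add: nn_integral_measure_pmf nn_integral_count_space_nat)
       (intro suminf_cong, simp add: ennreal_power ennreal_mult'[symmetric] power_mult_distrib field_simps)
  also have "\<dots> = ennreal (exp (- r) * exp (r * b))"
    using assms sums_mult[OF exp_converges[of "r * b"], of "exp (- r)"]
    by (intro sums_unique[symmetric]) (subst sums_ennreal, auto)
  also have "exp (- r) * exp (r * b) = exp (r * (b - 1))"
    by (simp add: exp_add[symmetric] ring_distribs)
  finally show ?thesis .
qed

text \<open>Exactly \<open>k\<close> jumps cost a factor \<open>b ^ k\<close>, whose Poisson mean is
  \<open>exp (r * (b - 1))\<close>. Both laws have the same jump rate, hence the same mixing law
  over \<open>k\<close>, and Cauchy-Schwarz in \<open>k\<close> combines the conditional
  bounds.\<close>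

lemma chi2_bounded_compound_poisson:
  assumes P: "prob_space P" and Q: "prob_space Q" and [simp]: "sets Q = sets borel"
    and bound: "chi2_bounded (ennreal b) P Q" and "r > 0" "b > 0"
  shows "chi2_bounded (ennreal (exp (r * (b - 1)))) (compound_poisson r P) (compound_poisson r Q)"
  unfolding chi2_bounded_def
proof safe
  have [simp]: "sets P = sets borel"
    using bound by (simp add: chi2_bounded_def)
  note [simp] = sets_compound_poisson[OF P] sets_compound_poisson[OF Q]
    nn_integral_compound_poisson[OF P] nn_integral_compound_poisson[OF Q]
  show "x \<in> sets (compound_poisson r Q)" if "x \<in> sets (compound_poisson r P)" for x
    using that by simp
  show "x \<in> sets (compound_poisson r P)" if "x \<in> sets (compound_poisson r Q)" for x
    using that by simp
  fix f :: "real \<Rightarrow> ennreal"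
  assume "f \<in> borel_measurable (compound_poisson r Q)"
  then have [measurable]: "f \<in> borel_measurable borel"
    by (simp cong: measurable_cong_sets)
  let ?F = "\<lambda>k. \<integral>\<^sup>+x. f x \<partial>conv_power P k" and ?H = "\<lambda>k. \<integral>\<^sup>+x. (f x)\<^sup>2 \<partial>conv_power Q k"
  \<comment> \<open>Mutually inverse weights for Cauchy-Schwarz: the square of \<open>?s k\<close>
    is the conditional constant \<open>b ^ k\<close>, and \<open>?t k\<close> cancels that constant
    in the other factor.\<close>
  let ?s = "\<lambda>k. ennreal (sqrt b ^ k)" and ?t = "\<lambda>k. ennreal (1 / sqrt b ^ k)"
  have st: "?s k * ?t k = 1" for k
    using \<open>b > 0\<close> by (simp flip: ennreal_mult')
  have s2: "(?s k)\<^sup>2 = ennreal b ^ k" for k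
    using \<open>b > 0\<close> by (simp add: ennreal_power power_mult[symmetric] mult.commute[of _ 2])
      (simp add: power_mult)
  have FH: "(?F k)\<^sup>2 \<le> (?s k)\<^sup>2 * ?H k" for k
    unfolding s2
    by (rule chi2_boundedD[OF chi2_bounded_conv_power[OF P Q _ bound]])
       (auto simp: cong: measurable_cong_sets)
  have "(\<integral>\<^sup>+x. f x \<partial>compound_poisson r P)\<^sup>2 =
      (\<integral>\<^sup>+k. ?s k * (?t k * ?F k) \<partial>measure_pmf (poisson_pmf r))\<^sup>2"
    by (simp add: mult.assoc[symmetric] st)
  also have "\<dots> \<le> (\<integral>\<^sup>+k. (?s k)\<^sup>2 \<partial>measure_pmf (poisson_pmf r)) *
      (\<integral>\<^sup>+k. (?t k * ?F k)\<^sup>2 \<partial>measure_pmf (poisson_pmf r))"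
    by (rule Cauchy_Schwarz_nn_integral) auto
  also have "\<dots> \<le> ennreal (exp (r * (b - 1))) * (\<integral>\<^sup>+k. ?H k \<partial>measure_pmf (poisson_pmf r))"
  proof (intro mult_mono nn_integral_mono)
    show "(\<integral>\<^sup>+k. (?s k)\<^sup>2 \<partial>measure_pmf (poisson_pmf r)) \<le> ennreal (exp (r * (b - 1)))"
      using \<open>b > 0\<close> \<open>r > 0\<close> by (simp only: s2) (simp add: nn_integral_poisson_power)
    fix k
    have "(?t k * ?F k)\<^sup>2 \<le> (?t k)\<^sup>2 * ((?s k)\<^sup>2 * ?H k)"
      unfolding power_mult_distrib by (intro mult_left_mono FH) auto
    also have "\<dots> = (?s k * ?t k)\<^sup>2 * ?H k"
      by (simp only: power_mult_distrib mult_ac)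
    finally show "(?t k * ?F k)\<^sup>2 \<le> ?H k"
      by (simp only: st) simp
  qed auto
  finally show "(\<integral>\<^sup>+x. f x \<partial>compound_poisson r P)\<^sup>2 \<le>
      ennreal (exp (r * (b - 1))) * (\<integral>\<^sup>+x. (f x)\<^sup>2 \<partial>compound_poisson r Q)"
    by simp
qed

text \<open>Constants multiply over independent coordinates. One coordinate is split off; the
  induction hypothesis changes the measure on the others and \<open>bound\<close> the measure on the
  new one.\<close>

lemma chi2_bounded_PiM:
  assumes P: "prob_space P" and Q: "prob_space Q" and bound: "chi2_bounded c P Q" and "finite I"
  shows "chi2_bounded (c ^ card I) (PiM I (\<lambda>_. P)) (PiM I (\<lambda>_. Q))"
  using \<open>finite I\<close>
proof (induction I)
  case empty
  show ?case
    by (simp add: chi2_bounded_def PiM_empty nn_integral_count_space_finite)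
next
  case (insert i I)
  interpret P: prob_space P by fact
  interpret Q: prob_space Q by fact
  interpret PP: product_prob_space "\<lambda>_. P" UNIV ..
  interpret QQ: product_prob_space "\<lambda>_. Q" UNIV ..
  have [simp, measurable_cong]: "sets P = sets Q"
    using bound by (simp add: chi2_bounded_def)
  have [measurable_cong]: "sets (PiM J (\<lambda>_. P)) = sets (PiM J (\<lambda>_. Q))" for J :: "'b set"
    by (rule sets_PiM_cong) auto
  show ?case
    unfolding chi2_bounded_def
  proof (intro conjI ballI)
    show "sets (PiM (insert i I) (\<lambda>_. P)) = sets (PiM (insert i I) (\<lambda>_. Q))"
      by (rule sets_PiM_cong) auto
    fix f :: "_ \<Rightarrow> ennreal"
    assume f [measurable]: "f \<in> borel_measurable (PiM (insert i I) (\<lambda>_. Q))"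
    have f' [measurable]: "f \<in> borel_measurable (PiM (insert i I) (\<lambda>_. P))"
      by measurable
    have "(\<integral>\<^sup>+x. f x \<partial>PiM (insert i I) (\<lambda>_. P))\<^sup>2 =
        (\<integral>\<^sup>+x. \<integral>\<^sup>+y. f (x(i := y)) \<partial>P \<partial>PiM I (\<lambda>_. P))\<^sup>2"
      using insert f' by (subst PP.product_nn_integral_insert) auto
    also have "\<dots> \<le> c ^ card I * (\<integral>\<^sup>+x. (\<integral>\<^sup>+y. f (x(i := y)) \<partial>P)\<^sup>2 \<partial>PiM I (\<lambda>_. Q))"
      by (rule chi2_boundedD[OF insert.IH]) measurable
    also have "\<dots> \<le> c ^ card I * (\<integral>\<^sup>+x. c * (\<integral>\<^sup>+y. (f (x(i := y)))\<^sup>2 \<partial>Q) \<partial>PiM I (\<lambda>_. Q))"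
      by (intro mult_left_mono nn_integral_mono chi2_boundedD[OF bound]) auto
    also have "\<dots> = c * c ^ card I * (\<integral>\<^sup>+x. \<integral>\<^sup>+y. (f (x(i := y)))\<^sup>2 \<partial>Q \<partial>PiM I (\<lambda>_. Q))"
      by (subst nn_integral_cmult) (auto simp: mult_ac)
    also have "\<dots> = c ^ card (insert i I) * (\<integral>\<^sup>+x. (f x)\<^sup>2 \<partial>PiM (insert i I) (\<lambda>_. Q))"
      using insert by (subst QQ.product_nn_integral_insert) auto
    finally show "(\<integral>\<^sup>+x. f x \<partial>PiM (insert i I) (\<lambda>_. P))\<^sup>2 \<le>
        c ^ card (insert i I) * (\<integral>\<^sup>+x. (f x)\<^sup>2 \<partial>PiM (insert i I) (\<lambda>_. Q))" .
  qed
qed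

text \<open>Under \<open>P\<close> the mean distances of \<open>T\<close> to the two targets sum to
  at least the gap between them. The distance to \<open>\<theta>1\<close> is at most the root of its
  risk under \<open>P\<close>; the distance to \<open>\<theta>0\<close> is moved to \<open>Q\<close>
  at the cost of a factor \<open>sqrt c\<close>. So the gap is at most \<open>1 + sqrt c\<close>
  times the root of the larger risk.\<close>

lemma two_point_lower_bound:
  fixes \<theta>0 \<theta>1 c :: real
  assumes "prob_space P" and bound: "chi2_bounded (ennreal c) P Q" and "c \<ge> 0"
    and [measurable]: "T \<in> borel_measurable Q"
  shows "ennreal ((\<theta>1 - \<theta>0)\<^sup>2 / (1 + sqrt c)\<^sup>2) \<le>
    max (\<integral>\<^sup>+x. ennreal ((T x - \<theta>0)\<^sup>2) \<partial>Q) (\<integral>\<^sup>+x. ennreal ((T x - \<theta>1)\<^sup>2) \<partial>P)" (is "_ \<le> ?R")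
proof (cases ?R)
  \<comment> \<open>An infinite maximal risk leaves nothing to prove; otherwise \<open>R\<close> is
    its value.\<close>
  case (real R)
  interpret P: prob_space P by fact
  have [measurable_cong]: "sets P = sets Q"
    using bound by (simp add: chi2_bounded_def)
  have nn: "a \<le> sqrt b" if "(ennreal a)\<^sup>2 \<le> ennreal b" "a \<ge> 0" "b \<ge> 0" for a b
    using that by (simp add: ennreal_power real_le_rsqrt)
  have R: "(\<integral>\<^sup>+x. ennreal ((T x - \<theta>0)\<^sup>2) \<partial>Q) \<le> ennreal R"
    "(\<integral>\<^sup>+x. ennreal ((T x - \<theta>1)\<^sup>2) \<partial>P) \<le> ennreal R" "R \<ge> 0"
    using real by (metis max.cobounded1, metis max.cobounded2, simp)
  define A where "A = (\<integral>\<^sup>+x. ennreal \<bar>T x - \<theta>0\<bar> \<partial>P)"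
  define B where "B = (\<integral>\<^sup>+x. ennreal \<bar>T x - \<theta>1\<bar> \<partial>P)"
  have "A\<^sup>2 \<le> ennreal c * (\<integral>\<^sup>+x. (ennreal \<bar>T x - \<theta>0\<bar>)\<^sup>2 \<partial>Q)"
    unfolding A_def by (rule chi2_boundedD[OF bound]) measurable
  also have "\<dots> \<le> ennreal c * ennreal R"
    using R(1) by (intro mult_left_mono) (simp_all add: ennreal_power)
  finally have A: "A\<^sup>2 \<le> ennreal (c * R)"
    using \<open>c \<ge> 0\<close> R(3) by (simp add: ennreal_mult)
  have "B\<^sup>2 \<le> (\<integral>\<^sup>+x. 1\<^sup>2 \<partial>P) * (\<integral>\<^sup>+x. (ennreal \<bar>T x - \<theta>1\<bar>)\<^sup>2 \<partial>P)"
    using Cauchy_Schwarz_nn_integral[of "\<lambda>_. 1" P "\<lambda>x. ennreal \<bar>T x - \<theta>1\<bar>"] by (simp add: B_def)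
  also have "\<dots> \<le> ennreal R"
    using R(2) by (simp add: ennreal_power P.emeasure_space_1)
  finally have B: "B\<^sup>2 \<le> ennreal R" .
  have fin: "A \<noteq> \<top>" "B \<noteq> \<top>"
    using A B by (auto simp: top_unique power2_eq_square ennreal_top_mult)
  then obtain a b where ab: "A = ennreal a" "a \<ge> 0" "B = ennreal b" "b \<ge> 0"
    by (metis ennreal_cases)
  have "ennreal \<bar>\<theta>1 - \<theta>0\<bar> = (\<integral>\<^sup>+x. ennreal \<bar>\<theta>1 - \<theta>0\<bar> \<partial>P)"
    by (simp add: P.emeasure_space_1)
  also have "\<dots> \<le> (\<integral>\<^sup>+x. ennreal \<bar>T x - \<theta>0\<bar> + ennreal \<bar>T x - \<theta>1\<bar> \<partial>P)"
    by (intro nn_integral_mono) (simp flip: ennreal_plus)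
  also have "\<dots> = A + B"
    unfolding A_def B_def by (rule nn_integral_add) measurable
  finally have "\<bar>\<theta>1 - \<theta>0\<bar> \<le> a + b"
    using ab by (simp flip: ennreal_plus)
  also have "\<dots> \<le> sqrt (c * R) + sqrt R"
    using A B ab \<open>c \<ge> 0\<close> real by (intro add_mono nn) auto
  also have "\<dots> = (1 + sqrt c) * sqrt R"
    by (simp add: real_sqrt_mult algebra_simps)
  finally have "(\<theta>1 - \<theta>0)\<^sup>2 \<le> ((1 + sqrt c) * sqrt R)\<^sup>2"
    by (simp add: abs_le_square_iff[symmetric] real \<open>c \<ge> 0\<close>)
  then have "(\<theta>1 - \<theta>0)\<^sup>2 \<le> R * (1 + sqrt c)\<^sup>2"
    using real by (simp add: power_mult_distrib mult.commute)
  then have "(\<theta>1 - \<theta>0)\<^sup>2 / (1 + sqrt c)\<^sup>2 \<le> R"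
    using \<open>c \<ge> 0\<close> by (intro divide_le_eq[THEN iffD2]) (auto simp: add_nonneg_eq_0_iff)
  then show ?thesis
    using real by (simp add: ennreal_leI)
qed simp

section \<open>Hoelder classes\<close>

text \<open>\<open>deriv\<close> is a total function, so additivity needs true differentiability at
  every order below \<open>n\<close>. This is what membership in \<open>holder_class\<close>
  supplies when \<open>n\<close> is \<open>holder_order \<beta>\<close>.\<close>

lemma higher_deriv_add:
  fixes f g :: "real \<Rightarrow> real"
  assumes "\<And>k x. k < n \<Longrightarrow> (deriv ^^ k) f differentiable (at x)"
    and "\<And>k x. k < n \<Longrightarrow> (deriv ^^ k) g differentiable (at x)"
  shows "(deriv ^^ n) (\<lambda>x. f x + g x) = (\<lambda>x. (deriv ^^ n) f x + (deriv ^^ n) g x)"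
  using assms
proof (induction n)
  case (Suc n)
  have "deriv (\<lambda>x. (deriv ^^ n) f x + (deriv ^^ n) g x) x =
      deriv ((deriv ^^ n) f) x + deriv ((deriv ^^ n) g) x" for x
    using Suc.prems[of n x] by (intro deriv_add) (simp_all add: field_differentiable_def real_differentiable_def)
  then show ?case by (simp add: Suc)
qed simp

lemma higher_deriv_cmult:
  fixes f :: "real \<Rightarrow> real"
  assumes "\<And>k x. k < n \<Longrightarrow> (deriv ^^ k) f differentiable (at x)"
  shows "(deriv ^^ n) (\<lambda>x. c * f x) = (\<lambda>x. c * (deriv ^^ n) f x)"
  using assms
proof (induction n)
  case (Suc n)
  have "deriv (\<lambda>x. c * (deriv ^^ n) f x) x = c * deriv ((deriv ^^ n) f) x" for x
    using Suc.prems[of n x] by (intro deriv_cmult) (simp add: field_differentiable_def real_differentiable_def)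
  then show ?case by (simp add: Suc)
qed simp

lemma has_real_derivative_affine:
  assumes "(f has_real_derivative D) (at ((x - c) / h))"
  shows "((\<lambda>x. f ((x - c) / h) / h ^ n) has_real_derivative D / h ^ Suc n) (at x)"
proof -
  have "((\<lambda>x. f ((x - c) / h)) has_real_derivative D * (1 / h)) (at x)"
    by (rule DERIV_chain2[where f = f and g = "\<lambda>x. (x - c) / h", OF assms])
      (rule DERIV_cong[OF DERIV_cdivide[OF DERIV_diff[OF DERIV_ident DERIV_const]]], simp)
  then show ?thesis
    by (auto dest: DERIV_cdivide[where c = "h ^ n"] simp: mult.commute)
qed

lemma higher_deriv_affine:
  fixes f :: "real \<Rightarrow> real"
  assumes "\<And>k x. k < n \<Longrightarrow> (deriv ^^ k) f differentiable (at x)"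
  shows "(deriv ^^ n) (\<lambda>x. f ((x - c) / h)) = (\<lambda>x. (deriv ^^ n) f ((x - c) / h) / h ^ n)"
  using assms
proof (induction n)
  case (Suc n)
  have "deriv (\<lambda>x. (deriv ^^ n) f ((x - c) / h) / h ^ n) x = deriv ((deriv ^^ n) f) ((x - c) / h) / h ^ Suc n" for x
    using Suc.prems[of n] by (intro DERIV_imp_deriv has_real_derivative_affine)
      (simp add: DERIV_deriv_iff_real_differentiable)
  then show ?case by (simp add: Suc)
qed simp

lemma holder_class_add:
  assumes "f \<in> holder_class \<beta> L" "g \<in> holder_class \<beta> M"
  shows "(\<lambda>x. f x + g x) \<in> holder_class \<beta> (L + M)"
proof -
  let ?l = "holder_order \<beta>"
  have f: "(deriv ^^ k) f differentiable (at x)" and g: "(deriv ^^ k) g differentiable (at x)"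
    if "k < ?l" for k x
    using that assms by (auto simp: holder_class_def)
  have add: "(deriv ^^ k) (\<lambda>x. f x + g x) = (\<lambda>x. (deriv ^^ k) f x + (deriv ^^ k) g x)" if "k \<le> ?l" for k
    using that f g by (intro higher_deriv_add) auto
  have "\<bar>(deriv ^^ ?l) f x + (deriv ^^ ?l) g x - ((deriv ^^ ?l) f y + (deriv ^^ ?l) g y)\<bar>
      \<le> (L + M) * \<bar>x - y\<bar> powr (\<beta> - real ?l)" for x y
  proof -
    have "\<bar>(deriv ^^ ?l) f x + (deriv ^^ ?l) g x - ((deriv ^^ ?l) f y + (deriv ^^ ?l) g y)\<bar>
        \<le> \<bar>(deriv ^^ ?l) f x - (deriv ^^ ?l) f y\<bar> + \<bar>(deriv ^^ ?l) g x - (deriv ^^ ?l) g y\<bar>"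
      by linarith
    also have "\<dots> \<le> L * \<bar>x - y\<bar> powr (\<beta> - real ?l) + M * \<bar>x - y\<bar> powr (\<beta> - real ?l)"
      using assms by (intro add_mono) (auto simp: holder_class_def)
    finally show ?thesis by (simp add: distrib_right)
  qed
  then show ?thesis
    using f g by (auto simp: holder_class_def add less_imp_le)
qed

lemma holder_class_cmult:
  assumes "f \<in> holder_class \<beta> L"
  shows "(\<lambda>x. c * f x) \<in> holder_class \<beta> (\<bar>c\<bar> * L)"
proof -
  let ?l = "holder_order \<beta>"
  have f: "(deriv ^^ k) f differentiable (at x)" if "k < ?l" for k x
    using that assms by (auto simp: holder_class_def)
  have cmult: "(deriv ^^ k) (\<lambda>x. c * f x) = (\<lambda>x. c * (deriv ^^ k) f x)" if "k \<le> ?l" for k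
    using that f by (intro higher_deriv_cmult) auto
  have "\<bar>c * (deriv ^^ ?l) f x - c * (deriv ^^ ?l) f y\<bar> \<le> \<bar>c\<bar> * L * \<bar>x - y\<bar> powr (\<beta> - real ?l)" for x y
    using assms
    by (auto simp: holder_class_def abs_mult mult.assoc mult_left_mono simp flip: right_diff_distrib)
  then show ?thesis
    using f by (auto simp: holder_class_def cmult less_imp_le intro!: differentiable_mult)
qed

lemma holder_class_mono:
  assumes "f \<in> holder_class \<beta> L" "L \<le> M"
  shows "f \<in> holder_class \<beta> M"
  using assms unfolding holder_class_def
  by (auto intro!: order_trans[OF _ mult_right_mono[OF \<open>L \<le> M\<close>]])

text \<open>With \<open>l\<close> the Hoelder order, \<open>l\<close> derivatives contribute
  \<open>h\<close> to the power \<open>-l\<close>, and rescaling the distance contributes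
  \<open>h\<close> to the power \<open>l - \<beta>\<close>. A prefactor
  \<open>h powr \<beta>\<close> therefore makes the Hoelder constant independent of the
  scale.\<close>

lemma holder_class_affine:
  assumes "f \<in> holder_class \<beta> L" "h > 0"
  shows "(\<lambda>x. f ((x - c) / h)) \<in> holder_class \<beta> (L / h powr \<beta>)"
proof -
  let ?l = "holder_order \<beta>"
  have f: "(deriv ^^ k) f differentiable (at x)" if "k < ?l" for k x
    using that assms by (auto simp: holder_class_def)
  have aff: "(deriv ^^ k) (\<lambda>x. f ((x - c) / h)) = (\<lambda>x. (deriv ^^ k) f ((x - c) / h) / h ^ k)" if "k \<le> ?l" for k
    using that f by (intro higher_deriv_affine) auto
  have "\<bar>(deriv ^^ ?l) f ((x - c) / h) / h ^ ?l - (deriv ^^ ?l) f ((y - c) / h) / h ^ ?l\<bar>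
      \<le> L / h powr \<beta> * \<bar>x - y\<bar> powr (\<beta> - real ?l)" for x y
  proof -
    have "\<bar>(deriv ^^ ?l) f ((x - c) / h) / h ^ ?l - (deriv ^^ ?l) f ((y - c) / h) / h ^ ?l\<bar> =
        \<bar>(deriv ^^ ?l) f ((x - c) / h) - (deriv ^^ ?l) f ((y - c) / h)\<bar> / h ^ ?l"
      using \<open>h > 0\<close> by (simp flip: diff_divide_distrib)
    also have "\<dots> \<le> L * \<bar>(x - c) / h - (y - c) / h\<bar> powr (\<beta> - real ?l) / h ^ ?l"
      using assms by (intro divide_right_mono) (auto simp: holder_class_def)
    also have "\<bar>(x - c) / h - (y - c) / h\<bar> = \<bar>x - y\<bar> / h"
      using \<open>h > 0\<close> by (simp flip: diff_divide_distrib)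
    also have "L * (\<bar>x - y\<bar> / h) powr (\<beta> - real ?l) / h ^ ?l = L / h powr \<beta> * \<bar>x - y\<bar> powr (\<beta> - real ?l)"
      using \<open>h > 0\<close> by (simp add: powr_divide powr_diff powr_realpow)
    finally show ?thesis .
  qed
  moreover have "(\<lambda>x. (deriv ^^ k) f ((x - c) / h) / h ^ k) differentiable (at x)" if "k < ?l" for k x
    using f[OF that, of "(x - c) / h"] has_real_derivative_affine
    unfolding real_differentiable_def by blast
  ultimately show ?thesis
    by (auto simp: holder_class_def aff less_imp_le)
qed

section \<open>Hoelder bounds for polynomials times the Gaussian density\<close>

lemma holder_order_bounds:
  assumes "\<beta> > 0"
  shows "real (holder_order \<beta>) < \<beta>" "\<beta> \<le> real (holder_order \<beta>) + 1"
  using assms unfolding holder_order_def by linarith+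

text \<open>Up to distance 1 the Lipschitz bound suffices, since the distance is below its power of
  exponent \<open>\<gamma> \<le> 1\<close>. Beyond distance 1 the power is at least 1 and the bound
  on \<open>f\<close> itself suffices.\<close>

lemma abs_diff_le_powr:
  fixes f f' :: "real \<Rightarrow> real"
  assumes "\<And>x. (f has_real_derivative f' x) (at x)"
    and f: "\<And>x. \<bar>f x\<bar> \<le> A" and f': "\<And>x. \<bar>f' x\<bar> \<le> B" and "0 < \<gamma>" "\<gamma> \<le> 1"
  shows "\<bar>f x - f y\<bar> \<le> (2 * A + B) * \<bar>x - y\<bar> powr \<gamma>"
proof -
  have AB: "A \<ge> 0" "B \<ge> 0"
    using f[of 0] f'[of 0] by linarith+
  have lip: "\<bar>f x - f y\<bar> \<le> B * \<bar>x - y\<bar>"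
    using field_differentiable_bound[of UNIV f f' B x y] assms by (auto simp: dist_norm)
  show ?thesis
  proof (cases "\<bar>x - y\<bar> \<le> 1")
    case True
    have "\<bar>x - y\<bar> \<le> \<bar>x - y\<bar> powr \<gamma>"
      using powr_mono'[of \<gamma> 1 "\<bar>x - y\<bar>"] True \<open>\<gamma> \<le> 1\<close> by simp
    then have "B * \<bar>x - y\<bar> \<le> (2 * A + B) * \<bar>x - y\<bar> powr \<gamma>"
      using AB by (intro mult_mono) auto
    with lip show ?thesis by linarith
  next
    case False
    then have "1 \<le> \<bar>x - y\<bar> powr \<gamma>"
      using \<open>0 < \<gamma>\<close> by (simp add: ge_one_powr_ge_zero)
    then have "(2 * A + B) * 1 \<le> (2 * A + B) * \<bar>x - y\<bar> powr \<gamma>"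
      using AB by (intro mult_left_mono) auto
    moreover have "\<bar>f x - f y\<bar> \<le> (2 * A + B) * 1"
      using abs_triangle_ineq4[of "f x" "f y"] f[of x] f[of y] AB(2) unfolding mult_1_right by linarith
    ultimately show ?thesis by linarith
  qed
qed

text \<open>A family closed under differentiation, which sends \<open>p\<close> to
  \<open>p' - x p\<close>, and under multiplication by \<open>x\<close>. It contains the bump, the
  product of the bump with \<open>x\<close>, and all their derivatives, so the same estimates serve
  them all.\<close>

definition gauss_poly :: "real poly \<Rightarrow> real \<Rightarrow> real" where
  "gauss_poly p x = poly p x * std_normal_density x"

lemma gauss_poly_has_derivative:
  "(gauss_poly p has_real_derivative gauss_poly (pderiv p - pCons 0 p) x) (at x)"
proof -
  have "(std_normal_density has_real_derivative - x * std_normal_density x) (at x)"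
    unfolding std_normal_density_def
    by (rule DERIV_cong[OF DERIV_cmult]) (auto intro!: derivative_eq_intros)
  from DERIV_mult[OF poly_DERIV[of p x] this] show ?thesis
    unfolding gauss_poly_def by (simp add: algebra_simps)
qed

lemma gauss_poly_higher_deriv:
  "(deriv ^^ k) (gauss_poly p) = gauss_poly (((\<lambda>p. pderiv p - pCons 0 p) ^^ k) p)"
  by (induction k) (auto intro!: DERIV_imp_deriv gauss_poly_has_derivative)

text \<open>Induction on the coefficients with the rate left free: half of the exponential absorbs
  the new factor \<open>x\<close>, and the other half is left to the induction hypothesis at rate
  \<open>c / 2\<close>.\<close>

lemma poly_mult_gaussian_bounded:
  fixes p :: "real poly"
  assumes "c > 0"
  obtains B where "B > 0" "\<And>x. \<bar>poly p x\<bar> * exp (- c * x\<^sup>2) \<le> B"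
proof -
  have "\<exists>B>0. \<forall>x. \<bar>poly p x\<bar> * exp (- c * x\<^sup>2) \<le> B"
    using assms
  proof (induction p arbitrary: c)
    case 0
    show ?case by (auto intro: exI[of _ 1])
  next
    case (pCons a p)
    then obtain B where B: "B > 0" "\<And>x. \<bar>poly p x\<bar> * exp (- (c / 2) * x\<^sup>2) \<le> B"
      by (metis half_gt_zero)
    have x: "\<bar>x\<bar> * exp (- (c / 2) * x\<^sup>2) \<le> 1 + 2 / c" for x
    proof -
      have "\<bar>x\<bar> \<le> 1 + x\<^sup>2"
        using zero_le_power2[of "\<bar>x\<bar> - 1"] abs_ge_zero[of x] unfolding power2_diff by simp
      also have "\<dots> \<le> (1 + 2 / c) * (1 + c / 2 * x\<^sup>2)"
        using \<open>c > 0\<close> by (simp add: field_simps)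
      also have "\<dots> \<le> (1 + 2 / c) * exp (c / 2 * x\<^sup>2)"
        using \<open>c > 0\<close> by (intro mult_left_mono exp_ge_add_one_self) auto
      finally show ?thesis
        by (simp add: exp_minus field_simps)
    qed
    have "\<bar>poly (pCons a p) x\<bar> * exp (- c * x\<^sup>2) \<le> \<bar>a\<bar> + (1 + 2 / c) * B" for x
    proof -
      have "\<bar>poly (pCons a p) x\<bar> * exp (- c * x\<^sup>2) \<le> (\<bar>a\<bar> + \<bar>x\<bar> * \<bar>poly p x\<bar>) * exp (- c * x\<^sup>2)"
        using abs_triangle_ineq[of a "x * poly p x"] by (intro mult_right_mono) (auto simp: abs_mult)
      also have "\<dots> = \<bar>a\<bar> * exp (- c * x\<^sup>2) +
          (\<bar>x\<bar> * exp (- (c / 2) * x\<^sup>2)) * (\<bar>poly p x\<bar> * exp (- (c / 2) * x\<^sup>2))"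
        by (simp add: algebra_simps flip: exp_add)
      also have "\<dots> \<le> \<bar>a\<bar> * 1 + (1 + 2 / c) * B"
        using \<open>c > 0\<close> by (intro add_mono mult_mono x B(2)) auto
      finally show ?thesis by simp
    qed
    moreover have "\<bar>a\<bar> + (1 + 2 / c) * B > 0"
      using \<open>c > 0\<close> \<open>B > 0\<close> by (intro add_nonneg_pos mult_pos_pos) (auto intro: add_pos_pos)
    ultimately show ?case by blast
  qed
  then show thesis using that by blast
qed

text \<open>Half of the Gaussian exponent absorbs the polynomial and the other half remains as
  decay. The slower decay is harmless later, when the argument is divided by
  \<open>h \<le> 1 / 2\<close>.\<close>

lemma gauss_poly_bound:
  obtains B where "B > 0" "\<And>x. \<bar>gauss_poly p x\<bar> \<le> B * exp (- (x\<^sup>2 / 4))"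
proof -
  obtain B where B: "B > 0" "\<And>x. \<bar>poly p x\<bar> * exp (- (1 / 4) * x\<^sup>2) \<le> B"
    using poly_mult_gaussian_bounded[of "1 / 4" p] by auto
  have "\<bar>gauss_poly p x\<bar> \<le> B * exp (- (x\<^sup>2 / 4))" for x
  proof -
    have "1 \<le> sqrt (2 * pi)"
      using pi_gt3 by (intro real_le_rsqrt) auto
    then have "1 / sqrt (2 * pi) * exp (- x\<^sup>2 / 2) \<le> 1 * exp (- x\<^sup>2 / 2)"
      by (intro mult_right_mono) auto
    then have "\<bar>gauss_poly p x\<bar> \<le> \<bar>poly p x\<bar> * (1 * exp (- x\<^sup>2 / 2))"
      unfolding gauss_poly_def std_normal_density_def abs_mult
      by (intro mult_left_mono) auto
    also have "\<dots> = (\<bar>poly p x\<bar> * exp (- (1 / 4) * x\<^sup>2)) * exp (- (x\<^sup>2 / 4))"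
      by (simp flip: exp_add)
    also have "\<dots> \<le> B * exp (- (x\<^sup>2 / 4))"
      by (intro mult_right_mono B) auto
    finally show ?thesis .
  qed
  with \<open>B > 0\<close> that show thesis by blast
qed

text \<open>The derivatives of orders \<open>l\<close> and \<open>l + 1\<close> are again Gaussian
  polynomials, hence bounded, and the Hoelder exponent \<open>\<beta> - l\<close> lies in the
  half-open interval from 0 to 1, with value 1 for integer \<beta>.\<close>

lemma gauss_poly_holder_class:
  assumes "\<beta> > 0"
  obtains B where "B > 0" "gauss_poly p \<in> holder_class \<beta> B"
proof -
  let ?l = "holder_order \<beta>" and ?D = "\<lambda>k. ((\<lambda>p. pderiv p - pCons 0 p) ^^ k) p"
  obtain A where A: "A > 0" "\<And>x. \<bar>gauss_poly (?D ?l) x\<bar> \<le> A * exp (- (x\<^sup>2 / 4))"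
    using gauss_poly_bound by blast
  obtain B where B: "B > 0" "\<And>x. \<bar>gauss_poly (?D (Suc ?l)) x\<bar> \<le> B * exp (- (x\<^sup>2 / 4))"
    using gauss_poly_bound by blast
  have le: "\<bar>gauss_poly (?D ?l) x\<bar> \<le> A" "\<bar>gauss_poly (?D (Suc ?l)) x\<bar> \<le> B" for x
  proof -
    have "A * exp (- (x\<^sup>2 / 4)) \<le> A" "B * exp (- (x\<^sup>2 / 4)) \<le> B"
      using A B by auto
    then show "\<bar>gauss_poly (?D ?l) x\<bar> \<le> A" "\<bar>gauss_poly (?D (Suc ?l)) x\<bar> \<le> B"
      using A(2)[of x] B(2)[of x] by linarith+
  qed
  have "\<bar>gauss_poly (?D ?l) x - gauss_poly (?D ?l) y\<bar> \<le> (2 * A + B) * \<bar>x - y\<bar> powr (\<beta> - real ?l)" for x y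
    using holder_order_bounds[OF assms] le
    by (intro abs_diff_le_powr[where f' = "gauss_poly (?D (Suc ?l))"])
       (auto intro: gauss_poly_has_derivative)
  moreover have "gauss_poly q differentiable (at x)" for q x
    using gauss_poly_has_derivative real_differentiable_def by blast
  ultimately have "gauss_poly p \<in> holder_class \<beta> (2 * A + B)"
    by (auto simp: holder_class_def gauss_poly_higher_deriv)
  moreover have "2 * A + B > 0" using A B by simp
  ultimately show thesis using that by blast
qed

lemma integrable_gauss_poly: "integrable lborel (gauss_poly p)"
proof -
  have "integrable lborel (\<lambda>x. \<Sum>i\<le>degree p. coeff p i * (std_normal_density x * x ^ i))"
    by (intro Bochner_Integration.integrable_sum integrable_mult_right integrable_std_normal_moment)
  also have "(\<lambda>x. \<Sum>i\<le>degree p. coeff p i * (std_normal_density x * x ^ i)) = gauss_poly p"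
    by (simp add: fun_eq_iff gauss_poly_def poly_altdef sum_distrib_left sum_distrib_right mult_ac)
  finally show ?thesis .
qed

section \<open>The two hypotheses and the lower bound\<close>

text \<open>The polynomial \<open>1 - x^2\<close>, so that \<open>gauss_poly bump_poly\<close> is
  minus the second derivative of the normal density. Its mean is zero, which preserves the jump
  rate, and its value at 0 is positive, which separates the two targets.\<close>

abbreviation bump_poly :: "real poly" where
  "bump_poly \<equiv> [:1, 0, -1:]"

text \<open>The moments of order 0 and 2 of the standard normal law are both 1 and cancel.\<close>

lemma integral_gauss_bump: "(\<integral>x. gauss_poly bump_poly x \<partial>lborel) = 0"
proof -
  have m0: "integrable lborel std_normal_density" "(\<integral>x. std_normal_density x \<partial>lborel) = 1"
    by (rule integrable_normal_density integral_normal_density, simp)+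
  have m2: "(\<integral>x. std_normal_density x * x\<^sup>2 \<partial>lborel) = 1"
    using integral_std_normal_moment_even[of 1] by simp
  have "gauss_poly bump_poly = (\<lambda>x. std_normal_density x - std_normal_density x * x\<^sup>2)"
    by (auto simp: gauss_poly_def algebra_simps power2_eq_square)
  then show ?thesis
    using m0 m2 integrable_std_normal_moment[of 2] by simp
qed

lemma integrable_affine:
  fixes f :: "real \<Rightarrow> real"
  assumes "integrable lborel f" "h > 0"
  shows "integrable lborel (\<lambda>x. f ((x - c) / h))"
  using lborel_integrable_real_affine[OF assms(1), of "1 / h" "- c / h"] \<open>h > 0\<close>
  by (simp add: diff_divide_distrib)

lemma integral_affine:
  fixes f :: "real \<Rightarrow> real"
  assumes "h > 0"
  shows "(\<integral>x. f ((x - c) / h) \<partial>lborel) = h * (\<integral>x. f x \<partial>lborel)"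
  using lborel_integral_real_affine[of "1 / h" f "- c / h"] \<open>h > 0\<close>
  by (simp add: diff_divide_distrib)

text \<open>Up to normalisation the integrand is the normal density with mean \<open>c\<close> and
  standard deviation \<open>sqrt 2 * h\<close>.\<close>

lemma integral_exp_affine:
  assumes "h > 0"
  shows "integrable lborel (\<lambda>x. exp (- (((x - c) / h)\<^sup>2 / 4)))"
    and "(\<integral>x. exp (- (((x - c) / h)\<^sup>2 / 4)) \<partial>lborel) = 2 * sqrt pi * h"
proof -
  have eq: "exp (- (((x - c) / h)\<^sup>2 / 4)) = 2 * sqrt pi * h * normal_density c (sqrt 2 * h) x" for x
    using \<open>h > 0\<close> by (simp add: normal_density_def power_mult_distrib power_divide real_sqrt_mult)
  have *: "sqrt 2 * h > 0" using \<open>h > 0\<close> by simp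
  show "integrable lborel (\<lambda>x. exp (- (((x - c) / h)\<^sup>2 / 4)))"
    unfolding eq using integrable_normal_density[OF *] by simp
  show "(\<integral>x. exp (- (((x - c) / h)\<^sup>2 / 4)) \<partial>lborel) = 2 * sqrt pi * h"
    unfolding eq using integral_normal_density[OF *] by simp
qed

text \<open>Finite mass implies the Levy integrability condition because \<open>min 1 (x^2)\<close>
  is at most 1.\<close>

lemma levy_holder_classI:
  assumes int: "integrable lborel N" and "\<And>x. 0 \<le> N x"
    and "integrable lborel (\<lambda>x. x * N x)" "(\<lambda>x. x * N x) \<in> holder_class \<beta> L"
  shows "N \<in> levy_holder_class \<beta> L"
proof -
  have [measurable]: "N \<in> borel_measurable borel"
    using int by auto
  have "integrable lborel (\<lambda>x. min 1 (x\<^sup>2) * N x)"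
    by (rule Bochner_Integration.integrable_bound[OF int])
       (auto simp: abs_mult assms mult_le_cancel_right1 abs_le_iff intro!: mult_left_le_one_le)
  with assms show ?thesis
    by (auto simp: levy_holder_class_def levy_density_def)
qed

text \<open>The constants may depend on \<open>c\<close> but are fixed before the scale
  \<open>h\<close>. Since \<open>w\<close> has mean zero, the term linear in \<open>w\<close> drops
  out of the last integral; what remains is of order \<open>h powr (2 * \<beta>)\<close> from the
  squared height of the bump, times \<open>h\<close> from its width.\<close>

lemma levy_holder_perturbation:
  fixes \<beta> L c :: real
  assumes "\<beta> > 0" "L > 0"
  obtains A a K where "A > 0" "a > 0" "K > 0"
    "(\<lambda>x. A * std_normal_density x) \<in> levy_holder_class \<beta> L"
    "\<And>h w. 0 < h \<Longrightarrow> h \<le> 1 / 2 \<Longrightarrow> w = (\<lambda>x. a * h powr \<beta> * gauss_poly bump_poly ((x - c) / h)) \<Longrightarrow>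
      (\<lambda>x. A * std_normal_density x + w x) \<in> levy_holder_class \<beta> L \<and>
      integrable lborel w \<and> (\<integral>x. w x \<partial>lborel) = 0 \<and> (\<forall>x. 0 \<le> A * std_normal_density x + w x) \<and>
      (\<integral>\<^sup>+x. ennreal ((A * std_normal_density x + w x)\<^sup>2 / (A * std_normal_density x)) \<partial>lborel)
        \<le> ennreal (A + K * h powr (2 * \<beta> + 1))"
proof -
  obtain B0 where B0: "B0 > 0" "gauss_poly [:0, 1:] \<in> holder_class \<beta> B0"
    using gauss_poly_holder_class[OF \<open>\<beta> > 0\<close>] .
  obtain B1 where B1: "B1 > 0" "gauss_poly bump_poly \<in> holder_class \<beta> B1"
    using gauss_poly_holder_class[OF \<open>\<beta> > 0\<close>] .
  obtain B2 where B2: "B2 > 0" "gauss_poly (pCons 0 bump_poly) \<in> holder_class \<beta> B2"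
    using gauss_poly_holder_class[OF \<open>\<beta> > 0\<close>] .
  obtain C where C: "C > 0" "\<And>x. \<bar>gauss_poly bump_poly x\<bar> \<le> C * exp (- (x\<^sup>2 / 4))"
    using gauss_poly_bound by blast
  \<comment> \<open>\<open>S\<close> compares the decay of the rescaled bump with the normal
    density, uniformly in \<open>h \<le> 1 / 2\<close>. \<open>A\<close> spends half of the Hoelder
    budget \<open>L\<close>. The first bound in \<open>a\<close> spends the other half on the
    perturbation, the second keeps the density nonnegative. \<open>K\<close> collects what is left
    after integrating the squared perturbation over the base density.\<close>
  define S where "S = exp (c\<^sup>2) * sqrt (2 * pi)"
  define A where "A = L / (2 * B0)"
  define a where "a = min (L / (2 * (\<bar>c\<bar> * B1 + B2))) (A / (C * S))"
  define K where "K = a\<^sup>2 * C\<^sup>2 * S / A * (2 * sqrt pi)"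
  have "S > 0" by (simp add: S_def)
  have "\<bar>c\<bar> * B1 + B2 > 0"
    using B1 B2 by (intro add_nonneg_pos) auto
  have "A > 0"
    using \<open>L > 0\<close> B0 by (simp add: A_def)
  have "a > 0"
    using \<open>L > 0\<close> \<open>\<bar>c\<bar> * B1 + B2 > 0\<close> \<open>A > 0\<close> \<open>C > 0\<close> \<open>S > 0\<close> by (simp add: a_def)
  have a1: "a * (\<bar>c\<bar> * B1 + B2) \<le> L / 2"
  proof -
    have "a \<le> L / (2 * (\<bar>c\<bar> * B1 + B2))" by (simp add: a_def)
    then show ?thesis using \<open>\<bar>c\<bar> * B1 + B2 > 0\<close> by (simp add: pos_le_divide_eq algebra_simps)
  qed
  have a2: "a * C * S \<le> A"
  proof -
    have "a \<le> A / (C * S)" by (simp add: a_def)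
    then show ?thesis using \<open>C > 0\<close> \<open>S > 0\<close> by (simp add: pos_le_divide_eq mult.assoc)
  qed
  have "K > 0"
    using \<open>a > 0\<close> \<open>C > 0\<close> \<open>S > 0\<close> \<open>A > 0\<close> by (simp add: K_def)
  have \<phi>: "integrable lborel std_normal_density" "(\<integral>x. std_normal_density x \<partial>lborel) = 1"
    by (rule integrable_normal_density integral_normal_density, simp)+
  have \<phi>_pos: "std_normal_density x > 0" for x
    by (rule normal_density_pos) simp
  have xN0: "(\<lambda>x. x * (A * std_normal_density x)) = (\<lambda>x. A * gauss_poly [:0, 1:] x)"
    by (simp add: fun_eq_iff gauss_poly_def mult_ac)
  have N0_holder: "(\<lambda>x. A * gauss_poly [:0, 1:] x) \<in> holder_class \<beta> (L / 2)"
    using holder_class_cmult[OF B0(2), of A] \<open>L > 0\<close> B0(1) by (simp add: A_def)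
  have N0: "(\<lambda>x. A * std_normal_density x) \<in> levy_holder_class \<beta> L"
    using \<phi> \<phi>_pos \<open>A > 0\<close> \<open>L > 0\<close> N0_holder
    by (intro levy_holder_classI)
       (auto simp: xN0 less_imp_le integrable_gauss_poly intro: holder_class_mono)
  show thesis
  proof (rule that[OF \<open>A > 0\<close> \<open>a > 0\<close> \<open>K > 0\<close> N0])
    fix h w
    assume h: "0 < h" "h \<le> 1 / 2"
      and w_def: "w = (\<lambda>x. a * h powr \<beta> * gauss_poly bump_poly ((x - c) / h))"
    let ?u = "\<lambda>x. (x - c) / h" and ?N = "\<lambda>x. A * std_normal_density x + w x"
    have powr_le: "h powr \<beta> \<le> 1"
      using h \<open>\<beta> > 0\<close> powr_le1[of \<beta> h] by simp
    have w_int: "integrable lborel w"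
      unfolding w_def using h by (intro integrable_mult_right integrable_affine integrable_gauss_poly)
    have w_mean: "(\<integral>x. w x \<partial>lborel) = 0"
      unfolding w_def using h by (simp add: integral_affine integral_gauss_bump)
    have w_le: "\<bar>w x\<bar> \<le> a * h powr \<beta> * C * exp (- ((?u x)\<^sup>2 / 4))" for x
      using C(2)[of "?u x"] \<open>a > 0\<close> h by (simp add: w_def abs_mult mult.assoc)
    \<comment> \<open>The shift by \<open>c\<close> is removed by expanding the square of
      \<open>x - 2 * c\<close>, at the price of the factor \<open>exp (c^2)\<close>. The bound
      \<open>h \<le> 1 / 2\<close> then makes the quarter of the squared rescaled argument at least
      the square of \<open>x - c\<close>.\<close>
    have exp_le: "exp (- ((?u x)\<^sup>2 / 4)) \<le> S * std_normal_density x" for x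
    proof -
      have "x\<^sup>2 / 2 - c\<^sup>2 \<le> (x - c)\<^sup>2"
        using zero_le_power2[of "x - 2 * c"] by (simp add: power2_eq_square algebra_simps)
      also have "(x - c)\<^sup>2 \<le> (?u x)\<^sup>2 / 4"
      proof -
        have "(x - c)\<^sup>2 * 4 \<le> (x - c)\<^sup>2 * (1 / h\<^sup>2)"
          using h power_mono[of h "1 / 2" 2]
          by (intro mult_left_mono) (auto simp: pos_le_divide_eq power_divide)
        then show ?thesis by (simp add: power_divide)
      qed
      finally have "exp (- ((?u x)\<^sup>2 / 4)) \<le> exp (c\<^sup>2 + - x\<^sup>2 / 2)"
        by simp
      also have "\<dots> = S * std_normal_density x"
        unfolding exp_add by (simp add: S_def std_normal_density_def)
      finally show ?thesis .
    qed
    have w_le_N0: "\<bar>w x\<bar> \<le> A * std_normal_density x" for x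
    proof -
      have "\<bar>w x\<bar> \<le> a * h powr \<beta> * C * (S * std_normal_density x)"
        using \<open>a > 0\<close> \<open>C > 0\<close> by (intro order_trans[OF w_le] mult_left_mono exp_le) auto
      also have "\<dots> = (a * C * S) * (h powr \<beta> * std_normal_density x)"
        by (simp add: mult_ac)
      also have "\<dots> \<le> A * (1 * std_normal_density x)"
        using \<open>A > 0\<close> \<phi>_pos[of x] powr_le by (intro mult_mono a2) auto
      finally show ?thesis by simp
    qed
    have nonneg: "0 \<le> ?N x" for x
      using w_le_N0[of x] by linarith
    have N_int: "integrable lborel ?N"
      using \<phi> w_int by simp
    \<comment> \<open>Writing \<open>x = c + h * ?u x\<close> turns multiplication by
      \<open>x\<close> into a combination of two rescaled Gaussian polynomials, to which the scaling
      rule for Hoelder classes applies.\<close>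
    have xN: "(\<lambda>x. x * ?N x) = (\<lambda>x. A * gauss_poly [:0, 1:] x + a * h powr \<beta> *
        (c * gauss_poly bump_poly (?u x) + h * gauss_poly (pCons 0 bump_poly) (?u x)))"
    proof
      fix x
      have x: "x = c + h * ?u x" using h by simp
      have "x * ?N x = A * gauss_poly [:0, 1:] x + a * h powr \<beta> *
          (x * gauss_poly bump_poly (?u x))"
        by (simp add: w_def gauss_poly_def algebra_simps)
      also have "x * gauss_poly bump_poly (?u x) = c * gauss_poly bump_poly (?u x) + h * (?u x * gauss_poly bump_poly (?u x))"
        by (subst (1) x) (simp only: ring_distribs mult.assoc)
      also have "?u x * gauss_poly bump_poly (?u x) = gauss_poly (pCons 0 bump_poly) (?u x)"
        by (simp add: gauss_poly_def)
      finally show "x * ?N x = A * gauss_poly [:0, 1:] x + a * h powr \<beta> *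
        (c * gauss_poly bump_poly (?u x) + h * gauss_poly (pCons 0 bump_poly) (?u x))" .
    qed
    have "(\<lambda>x. x * ?N x) \<in> holder_class \<beta> (L / 2 +
        \<bar>a * h powr \<beta>\<bar> * (\<bar>c\<bar> * (B1 / h powr \<beta>) + \<bar>h\<bar> * (B2 / h powr \<beta>)))"
      unfolding xN using h B1 B2
      by (intro holder_class_add N0_holder holder_class_cmult holder_class_affine)
    \<comment> \<open>The prefactor \<open>h powr \<beta>\<close> cancels the loss caused by
      rescaling.\<close>
    also have "\<bar>a * h powr \<beta>\<bar> * (\<bar>c\<bar> * (B1 / h powr \<beta>) + \<bar>h\<bar> * (B2 / h powr \<beta>)) = a * (\<bar>c\<bar> * B1 + h * B2)"
      using h \<open>a > 0\<close> by (simp add: field_simps)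
    finally have "(\<lambda>x. x * ?N x) \<in> holder_class \<beta> (L / 2 + a * (\<bar>c\<bar> * B1 + h * B2))" .
    moreover have "L / 2 + a * (\<bar>c\<bar> * B1 + h * B2) \<le> L"
    proof -
      have "a * (\<bar>c\<bar> * B1 + h * B2) \<le> a * (\<bar>c\<bar> * B1 + B2)"
        using h B2 \<open>a > 0\<close> by (intro mult_left_mono add_left_mono) auto
      with a1 show ?thesis by linarith
    qed
    ultimately have "(\<lambda>x. x * ?N x) \<in> holder_class \<beta> L"
      by (rule holder_class_mono)
    moreover have "integrable lborel (\<lambda>x. x * ?N x)"
      unfolding xN using h
      by (intro Bochner_Integration.integrable_add integrable_mult_right integrable_affine integrable_gauss_poly)
    ultimately have N1: "?N \<in> levy_holder_class \<beta> L"
      by (intro levy_holder_classI N_int nonneg)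
    \<comment> \<open>An integrable majorant of the squared perturbation over the base density: one
      of its two exponential factors is absorbed by that density through \<open>exp_le\<close>, the
      other is kept and integrates to a multiple of \<open>h\<close>.\<close>
    let ?v = "\<lambda>x. (a * h powr \<beta> * C)\<^sup>2 * S / A * exp (- ((?u x)\<^sup>2 / 4))"
    have v: "integrable lborel ?v" "(\<integral>x. ?v x \<partial>lborel) = K * h powr (2 * \<beta> + 1)"
      using h integral_exp_affine[of h c]
      by (simp_all add: K_def power_mult_distrib powr_add powr_power mult.commute[of 2 \<beta>])
    \<comment> \<open>The cross term \<open>2 * w x\<close> is kept exactly, not estimated, so that
      it vanishes on integration.\<close>
    have ratio: "(?N x)\<^sup>2 / (A * std_normal_density x) \<le> A * std_normal_density x + 2 * w x + ?v x" for x
    proof -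
      have expand: "(y + z)\<^sup>2 / y = y + 2 * z + z\<^sup>2 / y" if "y > 0" for y z :: real
        using that by (simp add: power2_eq_square field_simps)
      have pos: "A * std_normal_density x > 0" using \<open>A > 0\<close> \<phi>_pos by simp
      have "(?N x)\<^sup>2 / (A * std_normal_density x) =
          A * std_normal_density x + 2 * w x + (w x)\<^sup>2 / (A * std_normal_density x)"
        using expand[OF pos] .
      also have "(w x)\<^sup>2 / (A * std_normal_density x) \<le> ?v x"
      proof -
        have "(w x)\<^sup>2 \<le> (a * h powr \<beta> * C * exp (- ((?u x)\<^sup>2 / 4)))\<^sup>2"
          using power_mono[OF w_le[of x] abs_ge_zero, of 2] by simp
        also have "\<dots> = (a * h powr \<beta> * C)\<^sup>2 * exp (- ((?u x)\<^sup>2 / 4)) * exp (- ((?u x)\<^sup>2 / 4))"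
          by (simp add: power_mult_distrib power2_eq_square)
        also have "\<dots> \<le> (a * h powr \<beta> * C)\<^sup>2 * exp (- ((?u x)\<^sup>2 / 4)) * (S * std_normal_density x)"
          by (intro mult_left_mono exp_le) auto
        also have "\<dots> = ?v x * (A * std_normal_density x)"
          using \<open>A > 0\<close> by simp
        finally show ?thesis using pos by (simp add: pos_divide_le_eq)
      qed
      finally show ?thesis by simp
    qed
    have "(\<integral>\<^sup>+x. ennreal ((?N x)\<^sup>2 / (A * std_normal_density x)) \<partial>lborel)
        \<le> (\<integral>\<^sup>+x. ennreal (A * std_normal_density x + 2 * w x + ?v x) \<partial>lborel)"
      by (intro nn_integral_mono ennreal_leI ratio)
    also have "\<dots> = ennreal (\<integral>x. A * std_normal_density x + 2 * w x + ?v x \<partial>lborel)"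
    proof (rule nn_integral_eq_integral)
      show "AE x in lborel. 0 \<le> A * std_normal_density x + 2 * w x + ?v x"
        using \<phi>_pos \<open>A > 0\<close>
        by (intro AE_I2 order_trans[OF _ ratio]) (auto simp: less_imp_le)
    qed (use \<phi> w_int v in simp)
    also have "(\<integral>x. A * std_normal_density x + 2 * w x + ?v x \<partial>lborel) = A + K * h powr (2 * \<beta> + 1)"
    proof -
      have "(\<integral>x. A * std_normal_density x + 2 * w x + ?v x \<partial>lborel) =
          (\<integral>x. A * std_normal_density x + 2 * w x \<partial>lborel) + (\<integral>x. ?v x \<partial>lborel)"
        by (rule Bochner_Integration.integral_add) (use \<phi> w_int v in simp_all)
      then show ?thesis unfolding v(2) using \<phi> w_int w_mean by simp
    qed
    finally show "?N \<in> levy_holder_class \<beta> L \<and> integrable lborel w \<and> (\<integral>x. w x \<partial>lborel) = 0 \<and>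
        (\<forall>x. 0 \<le> ?N x) \<and> (\<integral>\<^sup>+x. ennreal ((?N x)\<^sup>2 / (A * std_normal_density x)) \<partial>lborel)
          \<le> ennreal (A + K * h powr (2 * \<beta> + 1))"
      using N1 w_int w_mean nonneg by blast
  qed
qed

section \<open>Two-point comparison at the critical bandwidth\<close>

theorem theorem3p5:
  fixes \<beta> L x\<^sub>0 :: real and \<Delta> :: "nat \<Rightarrow> real"
  assumes "\<beta> > 0" and "L > 0" and "x\<^sub>0 \<noteq> 0"
    and "\<forall>n. \<Delta> n > 0"
    and "\<Delta> \<in> O(\<lambda>_. 1)"
    and "(\<lambda>n. 1 / \<Delta> n) \<in> O(\<lambda>n. real n)"
  shows "\<exists>C > 0. \<forall>\<^sub>F n in sequentially.
    \<forall>ghat \<in> borel_measurable (PiM {..<n} (\<lambda>_. borel)).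
      (SUP N \<in> levy_holder_class \<beta> L.
         \<integral>\<^sup>+ Z. ennreal ((ghat Z - x\<^sub>0 * N x\<^sub>0)\<^sup>2)
           \<partial>(PiM {..<n} (\<lambda>_. levy_incr_law (\<Delta> n) N)))
      \<ge> ennreal (C * (real n * \<Delta> n) powr (- (2 * \<beta>) / (2 * \<beta> + 1)))"
proof -
  obtain A a K where "A > 0" "a > 0" "K > 0"
    and N0_class: "(\<lambda>x. A * std_normal_density x) \<in> levy_holder_class \<beta> L"
    and pert: "\<And>h w. 0 < h \<Longrightarrow> h \<le> 1 / 2 \<Longrightarrow>
      w = (\<lambda>x. a * h powr \<beta> * gauss_poly bump_poly ((x - x\<^sub>0) / h)) \<Longrightarrow>
      (\<lambda>x. A * std_normal_density x + w x) \<in> levy_holder_class \<beta> L \<and>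
      integrable lborel w \<and> (\<integral>x. w x \<partial>lborel) = 0 \<and> (\<forall>x. 0 \<le> A * std_normal_density x + w x) \<and>
      (\<integral>\<^sup>+x. ennreal ((A * std_normal_density x + w x)\<^sup>2 / (A * std_normal_density x)) \<partial>lborel)
        \<le> ennreal (A + K * h powr (2 * \<beta> + 1))"
    using levy_holder_perturbation[OF \<open>\<beta> > 0\<close> \<open>L > 0\<close>, of x\<^sub>0] by blast
  obtain M where "M > 0" and M: "\<forall>\<^sub>F n in sequentially. norm (1 / \<Delta> n) \<le> M * norm (real n)"
    using landau_o.bigE[OF \<open>(\<lambda>n. 1 / \<Delta> n) \<in> O(\<lambda>n. real n)\<close>] by blast
  \<comment> \<open>With \<open>h\<close> equal to \<open>\<kappa>\<close> times the power
    \<open>-\<rho>\<close> of the total observation time, \<open>h powr (2 * \<beta> + 1)\<close> is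
    inversely proportional to that time. \<open>\<kappa>\<close> is small enough for
    \<open>h \<le> 1 / 2\<close>, \<open>c\<close> is the resulting constant for all observations
    jointly, and \<open>C\<close> is what the two-point bound then yields.\<close>
  define \<rho> where "\<rho> = 1 / (2 * \<beta> + 1)"
  define \<kappa> where "\<kappa> = M powr (- \<rho>) / 2"
  define c where "c = exp (K * \<kappa> powr (2 * \<beta> + 1))"
  define C where "C = (x\<^sub>0 * a * \<kappa> powr \<beta> * std_normal_density 0)\<^sup>2 / (1 + sqrt c)\<^sup>2"
  have "\<rho> > 0" "\<kappa> > 0" "c > 0"
    using \<open>\<beta> > 0\<close> \<open>M > 0\<close> by (simp_all add: \<rho>_def \<kappa>_def c_def)
  have "1 + sqrt c > 0"
    using \<open>c > 0\<close> by (intro add_pos_nonneg) auto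
  have "C > 0"
    using \<open>x\<^sub>0 \<noteq> 0\<close> \<open>a > 0\<close> \<open>\<kappa> > 0\<close> \<open>1 + sqrt c > 0\<close> normal_density_pos[of 1 0 0] by (simp add: C_def)
  have \<phi>: "integrable lborel std_normal_density" "(\<integral>x. std_normal_density x \<partial>lborel) = 1"
    by (rule integrable_normal_density integral_normal_density, simp)+
  have \<phi>_pos: "std_normal_density x > 0" for x
    by (rule normal_density_pos) simp
  have "ennreal (C * (real n * \<Delta> n) powr (- (2 * \<beta>) / (2 * \<beta> + 1))) \<le>
      (SUP N \<in> levy_holder_class \<beta> L.
        \<integral>\<^sup>+ Z. ennreal ((ghat Z - x\<^sub>0 * N x\<^sub>0)\<^sup>2) \<partial>(PiM {..<n} (\<lambda>_. levy_incr_law (\<Delta> n) N)))"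
    if n: "norm (1 / \<Delta> n) \<le> M * norm (real n)"
      and ghat: "ghat \<in> borel_measurable (PiM {..<n} (\<lambda>_. borel))" for n ghat
  proof -
    define s where "s = real n * \<Delta> n"
    define h where "h = \<kappa> * s powr (- \<rho>)"
    define w where "w = (\<lambda>x. a * h powr \<beta> * gauss_poly bump_poly ((x - x\<^sub>0) / h))"
    define N0 where "N0 = (\<lambda>x. A * std_normal_density x)"
    define N1 where "N1 = (\<lambda>x. A * std_normal_density x + w x)"
    have "\<Delta> n > 0" using assms by blast
    \<comment> \<open>The growth condition on the inverse time step keeps the observation time
      \<open>s\<close> above \<open>1 / M\<close>, which bounds \<open>h\<close> from above.\<close>
    then have "1 \<le> M * s"
      using n by (simp add: s_def divide_le_eq mult.assoc)
    then have s: "1 / M \<le> s" "s > 0"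
      using \<open>M > 0\<close> by (simp_all add: divide_le_eq mult.commute)
        (metis less_le_trans mult.commute zero_less_mult_pos zero_less_one)
    have "h > 0" using \<open>\<kappa> > 0\<close> s by (simp add: h_def)
    have "s powr (- \<rho>) \<le> (1 / M) powr (- \<rho>)"
      using s \<open>M > 0\<close> \<open>\<rho> > 0\<close> by (intro powr_mono2') auto
    also have "\<dots> = M powr \<rho>"
      using \<open>M > 0\<close> by (simp add: powr_divide powr_minus field_simps)
    finally have "h \<le> \<kappa> * M powr \<rho>"
      using \<open>\<kappa> > 0\<close> by (simp add: h_def)
    then have "h \<le> 1 / 2"
      using \<open>M > 0\<close> by (simp add: \<kappa>_def powr_minus)
    note pert = pert[OF \<open>h > 0\<close> \<open>h \<le> 1 / 2\<close> w_def]
    have N1_class: "N1 \<in> levy_holder_class \<beta> L" and w_int: "integrable lborel w"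
      and w_mean: "(\<integral>x. w x \<partial>lborel) = 0" and N1_nonneg: "\<And>x. 0 \<le> N1 x"
      and ratio: "(\<integral>\<^sup>+x. ennreal ((N1 x)\<^sup>2 / N0 x) \<partial>lborel) \<le> ennreal (A + K * h powr (2 * \<beta> + 1))"
      using pert unfolding N1_def N0_def by auto
    have N0_pos: "0 < N0 x" for x
      using \<open>A > 0\<close> \<phi>_pos by (simp add: N0_def)
    have int: "integrable lborel N0" "integrable lborel N1"
      and mass: "(\<integral>x. N0 x \<partial>lborel) = A" "(\<integral>x. N1 x \<partial>lborel) = A"
      using \<phi> w_int w_mean by (simp_all add: N0_def N1_def)
    then have [measurable]: "N0 \<in> borel_measurable borel" "N1 \<in> borel_measurable borel"
      by auto
    let ?Q = "density lborel (\<lambda>x. ennreal (N0 x / A))" and ?P = "density lborel (\<lambda>x. ennreal (N1 x / A))"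
    note law0 = levy_incr_law_finite[OF _ less_imp_le[OF N0_pos] int(1) mass(1) \<open>A > 0\<close> \<open>\<Delta> n > 0\<close>]
    note law1 = levy_incr_law_finite[OF _ N1_nonneg int(2) mass(2) \<open>A > 0\<close> \<open>\<Delta> n > 0\<close>]
    \<comment> \<open>The chi-square constant of the jump laws: dividing both densities by the
      common mass \<open>A\<close> divides the integral of the ratio by \<open>A\<close>.\<close>
    define b where "b = 1 + K / A * h powr (2 * \<beta> + 1)"
    have "b > 0"
      using \<open>K > 0\<close> \<open>A > 0\<close> by (simp add: b_def add_pos_nonneg)
    have "chi2_bounded (\<integral>\<^sup>+x. ennreal ((N1 x / A)\<^sup>2 / (N0 x / A)) \<partial>lborel) ?P ?Q"
      using N0_pos N1_nonneg \<open>A > 0\<close> by (intro chi2_bounded_density) auto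
    moreover have "(\<integral>\<^sup>+x. ennreal ((N1 x / A)\<^sup>2 / (N0 x / A)) \<partial>lborel) \<le> ennreal b"
    proof -
      have "(\<integral>\<^sup>+x. ennreal ((N1 x / A)\<^sup>2 / (N0 x / A)) \<partial>lborel) =
          (\<integral>\<^sup>+x. ennreal (1 / A) * ennreal ((N1 x)\<^sup>2 / N0 x) \<partial>lborel)"
        using \<open>A > 0\<close> by (intro nn_integral_cong)
          (simp add: power_divide power2_eq_square flip: ennreal_mult')
      also have "\<dots> = ennreal (1 / A) * (\<integral>\<^sup>+x. ennreal ((N1 x)\<^sup>2 / N0 x) \<partial>lborel)"
        by (rule nn_integral_cmult) measurable
      also have "\<dots> \<le> ennreal (1 / A) * ennreal (A + K * h powr (2 * \<beta> + 1))"
        by (intro mult_left_mono ratio) simp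
      also have "\<dots> = ennreal b"
        using \<open>A > 0\<close> by (simp add: b_def add_divide_distrib flip: ennreal_mult')
      finally show ?thesis .
    qed
    ultimately have "chi2_bounded (ennreal b) ?P ?Q"
      by (rule chi2_bounded_mono)
    then have "chi2_bounded (ennreal (exp (\<Delta> n * A * (b - 1))))
        (compound_poisson (\<Delta> n * A) ?P) (compound_poisson (\<Delta> n * A) ?Q)"
      using law0(1) law1(1) \<open>b > 0\<close> \<open>A > 0\<close> \<open>\<Delta> n > 0\<close>
      by (intro chi2_bounded_compound_poisson) auto
    then have incr: "chi2_bounded (ennreal (exp (\<Delta> n * A * (b - 1))))
        (levy_incr_law (\<Delta> n) N1) (levy_incr_law (\<Delta> n) N0)"
      using law0(2) law1(2) by simp
    have prob: "prob_space (levy_incr_law (\<Delta> n) N0)" "prob_space (levy_incr_law (\<Delta> n) N1)"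
      and sets0: "sets (levy_incr_law (\<Delta> n) N0) = sets borel"
      using law0 law1 by (simp_all add: prob_space_compound_poisson sets_compound_poisson)
    \<comment> \<open>The exponents of the \<open>n\<close> increments add up to
      \<open>K * s * h powr (2 * \<beta> + 1)\<close>, and the choice of \<open>h\<close> makes this
      independent of \<open>n\<close>.\<close>
    have "ennreal (exp (\<Delta> n * A * (b - 1))) ^ card {..<n} = ennreal c"
    proof -
      have "h powr (2 * \<beta> + 1) = \<kappa> powr (2 * \<beta> + 1) * s powr (- \<rho> * (2 * \<beta> + 1))"
        using \<open>\<kappa> > 0\<close> s unfolding h_def by (simp add: powr_mult powr_powr)
      also have "- \<rho> * (2 * \<beta> + 1) = - 1"
        using \<open>\<beta> > 0\<close> by (simp add: \<rho>_def field_simps)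
      finally have "s * h powr (2 * \<beta> + 1) = \<kappa> powr (2 * \<beta> + 1)"
        using s by (simp add: powr_minus)
      then have "real n * (\<Delta> n * A * (b - 1)) = K * \<kappa> powr (2 * \<beta> + 1)"
        using \<open>A > 0\<close> by (simp add: b_def s_def mult_ac)
      then show ?thesis
        by (simp add: c_def ennreal_power flip: exp_of_nat_mult)
    qed
    then have prod: "chi2_bounded (ennreal c) (PiM {..<n} (\<lambda>_. levy_incr_law (\<Delta> n) N1))
        (PiM {..<n} (\<lambda>_. levy_incr_law (\<Delta> n) N0))"
      using chi2_bounded_PiM[OF prob(2,1) incr, of "{..<n}"] by simp
    have ghat': "ghat \<in> borel_measurable (PiM {..<n} (\<lambda>_. levy_incr_law (\<Delta> n) N0))"
      using ghat sets0 by (simp cong: measurable_cong_sets sets_PiM_cong)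
    \<comment> \<open>At \<open>x\<^sub>0\<close> the rescaled argument is 0 and the bump polynomial
      equals 1, so the targets differ by \<open>x\<^sub>0 * a * h powr \<beta>\<close> times the
      normal density at 0. Squaring gives the stated rate in \<open>s\<close>.\<close>
    have "C * s powr (- (2 * \<beta>) / (2 * \<beta> + 1)) = (x\<^sub>0 * N1 x\<^sub>0 - x\<^sub>0 * N0 x\<^sub>0)\<^sup>2 / (1 + sqrt c)\<^sup>2"
    proof -
      have "x\<^sub>0 * N1 x\<^sub>0 - x\<^sub>0 * N0 x\<^sub>0 = x\<^sub>0 * a * h powr \<beta> * std_normal_density 0"
        by (simp add: N1_def N0_def w_def gauss_poly_def algebra_simps)
      also have "h powr \<beta> = \<kappa> powr \<beta> * s powr (- \<rho> * \<beta>)"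
        using \<open>\<kappa> > 0\<close> s unfolding h_def by (simp add: powr_mult powr_powr)
      finally have "(x\<^sub>0 * N1 x\<^sub>0 - x\<^sub>0 * N0 x\<^sub>0)\<^sup>2 =
          (x\<^sub>0 * a * \<kappa> powr \<beta> * std_normal_density 0)\<^sup>2 * (s powr (- \<rho> * \<beta>))\<^sup>2"
        by (simp add: power_mult_distrib mult_ac)
      also have "(s powr (- \<rho> * \<beta>))\<^sup>2 = s powr (- (2 * \<beta>) / (2 * \<beta> + 1))"
        using s by (simp add: powr_power \<rho>_def mult.commute)
      finally show ?thesis by (simp add: C_def)
    qed
    then have "ennreal (C * s powr (- (2 * \<beta>) / (2 * \<beta> + 1))) \<le>
        max (\<integral>\<^sup>+ Z. ennreal ((ghat Z - x\<^sub>0 * N0 x\<^sub>0)\<^sup>2) \<partial>(PiM {..<n} (\<lambda>_. levy_incr_law (\<Delta> n) N0)))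
          (\<integral>\<^sup>+ Z. ennreal ((ghat Z - x\<^sub>0 * N1 x\<^sub>0)\<^sup>2) \<partial>(PiM {..<n} (\<lambda>_. levy_incr_law (\<Delta> n) N1)))"
      using two_point_lower_bound[OF prob_space_PiM prod less_imp_le[OF \<open>c > 0\<close>] ghat'] prob(2) by simp
    also have "\<dots> \<le> (SUP N \<in> levy_holder_class \<beta> L.
        \<integral>\<^sup>+ Z. ennreal ((ghat Z - x\<^sub>0 * N x\<^sub>0)\<^sup>2) \<partial>(PiM {..<n} (\<lambda>_. levy_incr_law (\<Delta> n) N)))"
      using N0_class N1_class unfolding N0_def[symmetric] by (intro max.boundedI SUP_upper)
    finally show ?thesis by (simp add: s_def)
  qed
  with M have "\<forall>\<^sub>F n in sequentially. \<forall>ghat \<in> borel_measurable (PiM {..<n} (\<lambda>_. borel)).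
      ennreal (C * (real n * \<Delta> n) powr (- (2 * \<beta>) / (2 * \<beta> + 1))) \<le>
      (SUP N \<in> levy_holder_class \<beta> L.
        \<integral>\<^sup>+ Z. ennreal ((ghat Z - x\<^sub>0 * N x\<^sub>0)\<^sup>2) \<partial>(PiM {..<n} (\<lambda>_. levy_incr_law (\<Delta> n) N)))"
    by (auto elim!: eventually_mono)
  with \<open>C > 0\<close> show ?thesis by blast
qed

end
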